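(* Let $X$ be a nonempty metric space. Then $$\mathrm{map\text{-}rad}(X,\mathbf{Conv})\ =\ \inf_\mu\ \sup_{x\in X}\ \int_{z\in X} d(x,z)\ d\mu(z),$$ where the infimum is over all probability measures $\mu$ on $X$ with finite support.
   Context: A map $f:X\to Y$ of metric spaces is nonexpansive if $d(f(x_0),f(x_1))\le d(x_0,x_1)$ for all $x_0,x_1\in X$; $\mathbf{Metr}(X,Y)$ denotes the set of nonexpansive maps $X\to Y$. For a nonempty subset $A$ of a metric space $Y$, $\mathrm{rad}_Y(A)=\inf_{y\in Y}\sup_{a\in A} d(a,y)\in[0,+\infty]$. For metric spaces $X,Y$, $\mathrm{map\text{-}rad}(X,Y)=\sup_{f\in\mathbf{Metr}(X,Y)}\mathrm{rad}_Y(f(X))$. For a class $\mathbf{Y}$ of metric spaces, $\mathrm{map\text{-}rad}(X,\mathbf{Y})=\sup_{Y\in\mathbf{Y}}\mathrm{map\text{-}rad}(X,Y)$. $\mathbf{Conv}$ is the class of all convex subsets of real normed vector spaces, regarded as metric spaces with the metric induced by the norm. A probability measure on $X$ with finite support is a measure of the form $\mu=\sum_{i=1}^n c_i\mu_{x_i}$ with $x_i\in X$, $c_i\ge 0$, $\sum c_i=1$, where $\mu_x$ is the unit point mass at $x$; thus $\int_{z\in X} d(x,z)\,d\mu(z)=\sum_i c_i\,d(x,x_i)$. *)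

theory Defs
  imports "HOL-Probability.Probability" "HOL-Algebra.Module"
begin

definition nonexpansive_maps :: "'a metric \<Rightarrow> 'b metric \<Rightarrow> ('a \<Rightarrow> 'b) set" where
  "nonexpansive_maps X Y =
     {f. f \<in> mspace X \<rightarrow> mspace Y \<and>
         (\<forall>x\<in>mspace X. \<forall>x'\<in>mspace X. mdist Y (f x) (f x') \<le> mdist X x x')}"

definition rad :: "'b metric \<Rightarrow> 'b set \<Rightarrow> ennreal" where
  "rad Y A = (INF y\<in>mspace Y. SUP a\<in>A. ennreal (mdist Y a y))"

definition map_rad :: "'a metric \<Rightarrow> 'b metric \<Rightarrow> ennreal" where
  "map_rad X Y = (SUP f\<in>nonexpansive_maps X Y. rad Y (f ` mspace X))"

definition map_rad_class :: "'a metric \<Rightarrow> 'b metric set \<Rightarrow> ennreal" where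
  "map_rad_class X \<Y> = (SUP Y\<in>\<Y>. map_rad X Y)"

text \<open>
  Real vector spaces are modules over the real field, with an arbitrary carrier set. The
  type class for real normed vector spaces fixes one structure per type and hence cannot
  be used to form a set of spaces.
\<close>

definition reals :: "real ring" where
  "reals = \<lparr>carrier = UNIV, mult = (*), one = 1, zero = 0, add = (+)\<rparr>"

locale real_normed_space = module reals V
  for V :: "(real, 'v) module" (structure) +
  fixes nrm :: "'v \<Rightarrow> real"
  assumes nrm_eq_0_iff: "x \<in> carrier V \<Longrightarrow> nrm x = 0 \<longleftrightarrow> x = \<zero>"
    and nrm_triangle: "\<lbrakk>x \<in> carrier V; y \<in> carrier V\<rbrakk> \<Longrightarrow> nrm (x \<oplus> y) \<le> nrm x + nrm y"
    and nrm_smult: "x \<in> carrier V \<Longrightarrow> nrm (c \<odot>\<^bsub>V\<^esub> x) = \<bar>c\<bar> * nrm x"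

definition convex_in :: "(real, 'v) module \<Rightarrow> 'v set \<Rightarrow> bool" where
  "convex_in V C \<longleftrightarrow> C \<subseteq> carrier V \<and>
     (\<forall>x\<in>C. \<forall>y\<in>C. \<forall>u\<ge>0. \<forall>v\<ge>0. u + v = 1 \<longrightarrow>
        u \<odot>\<^bsub>V\<^esub> x \<oplus>\<^bsub>V\<^esub> v \<odot>\<^bsub>V\<^esub> y \<in> C)"

text \<open>
  All convex subsets of real normed vector spaces whose vectors are elements of the type
  \<open>'v\<close>, which plays the role of a universe: the proper class of all such metric spaces is
  obtained by letting \<open>'v\<close> vary. To quantify over the whole class for a metric space with
  points in \<open>'a\<close>, use the universes \<open>'v + ('a \<Rightarrow> real)\<close> with \<open>'v\<close> arbitrary: the left
  summand accommodates any given normed space, while the right one rules out universes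
  that are too small to contain the normed spaces generated by the metric space (for a
  one-element type \<open>'v\<close> alone, only the zero space would be left). Values of \<open>mdist Y\<close> outside \<open>mspace Y\<close> are irrelevant.
\<close>

definition Conv :: "'v metric set" where
  "Conv = {Y. \<exists>V nrm. real_normed_space V nrm \<and> convex_in V (mspace Y) \<and>
     (\<forall>x\<in>mspace Y. \<forall>y\<in>mspace Y. mdist Y x y = nrm (x \<ominus>\<^bsub>V\<^esub> y))}"

text \<open>
  Every convex subset of every type of class \<open>real_normed_vector\<close> occurs, up to renaming
  of points, in each universe into which that type embeds.
\<close>

lemma Conv_real_normed_vector:
  fixes C :: "'b::real_normed_vector set" and e :: "'b \<Rightarrow> 'v"
  assumes C: "convex C" and e: "inj e"
  defines "Y \<equiv> metric (e ` C, \<lambda>x y. dist (inv_into UNIV e x) (inv_into UNIV e y))"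
  shows "mspace Y = e ` C"
    and "\<forall>x y. mdist Y (e x) (e y) = dist x y"
    and "Y \<in> Conv"
proof -
  let ?i = "inv_into UNIV e"
  have i [simp]: "?i (e x) = x" for x
    using e by simp
  interpret M: Metric_space "e ` C" "\<lambda>x y. dist (?i x) (?i y)"
    by unfold_locales (auto simp: dist_commute dist_triangle)
  show sp: "mspace Y = e ` C"
    by (simp add: Y_def)
  have ds: "mdist Y = (\<lambda>x y. dist (?i x) (?i y))"
    by (simp add: Y_def)
  then show "\<forall>x y. mdist Y (e x) (e y) = dist x y"
    by simp
  define V :: "(real, 'v) module" where
    "V = \<lparr>carrier = range e, mult = (\<lambda>x y. x), one = e 0, zero = e 0,
          add = (\<lambda>x y. e (?i x + ?i y)), smult = (\<lambda>c x. e (c *\<^sub>R ?i x))\<rparr>"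
  have ag: "abelian_group V"
  proof (rule abelian_groupI)
    fix x assume "x \<in> carrier V"
    then obtain a where "x = e a" by (auto simp: V_def)
    then show "\<exists>y\<in>carrier V. y \<oplus>\<^bsub>V\<^esub> x = \<zero>\<^bsub>V\<^esub>"
      by (intro bexI[of _ "e (- a)"]) (auto simp: V_def)
  qed (auto simp: V_def algebra_simps)
  interpret abelian_group V by (rule ag)
  have R: "cring reals"
  proof (rule cringI)
    show "abelian_group reals"
    proof (rule abelian_groupI)
      fix x assume "x \<in> carrier reals"
      show "\<exists>y\<in>carrier reals. y \<oplus>\<^bsub>reals\<^esub> x = \<zero>\<^bsub>reals\<^esub>"
        by (intro bexI[of _ "- x"]) (auto simp: reals_def)
    qed (auto simp: reals_def)
    show "comm_monoid reals"
      by (rule comm_monoidI) (auto simp: reals_def)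
  qed (auto simp: reals_def algebra_simps)
  have mo: "module reals V"
    by (rule moduleI[OF R ag])
      (auto simp: V_def reals_def scaleR_add_left scaleR_add_right)
  have nm: "real_normed_space V (\<lambda>x. norm (?i x))"
    using mo by (rule real_normed_space.intro, unfold_locales)
      (auto simp: V_def norm_triangle_ineq)
  have neg: "\<ominus>\<^bsub>V\<^esub> (e y) = e (- y)" for y
    by (rule minus_equality) (auto simp: V_def)
  have "convex_in V (e ` C)"
    using C by (fastforce simp: convex_in_def V_def convex_def)
  moreover have "e x \<ominus>\<^bsub>V\<^esub> e y = e (x - y)" for x y
    unfolding a_minus_def neg by (simp add: V_def)
  ultimately show "Y \<in> Conv"
    unfolding Conv_def mem_Collect_eq sp ds using nm
    by (intro exI[of _ V] exI[of _ "\<lambda>x. norm (?i x)"]) (auto simp: dist_norm)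
qed

end

theory Submission
  imports Defs
begin

text \<open>
  For the upper bound, the average of \<open>f\<close> over \<open>\<mu>\<close> is a centre for \<open>f(X)\<close>, by the triangle
  inequality. For the lower bound, the Kuratowski map \<open>x \<mapsto> d(\<cdot>, x) - d(\<cdot>, x\<^sub>0)\<close> into the
  bounded functions on \<open>X\<close>, with the convex hull of its image as target, is extremal: a centre
  in that hull is the average over some \<open>\<mu>\<close>, and the difference between the image of \<open>x\<close>
  and this centre takes the value \<open>- \<integral> d(x, z) d\<mu>(z)\<close> at the point \<open>x\<close>.
\<close>

section \<open>Barycentres in convex sets and the upper bound\<close>

text \<open>Since \<open>u + v = 1\<close>, \<open>z\<close> splits as a combination of itself with
  the same weights, and the difference becomes a combination of \<open>z - x\<close> and
  \<open>z - y\<close>.\<close>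

lemma (in real_normed_space) nrm_convex_combination:
  assumes [simp]: "x \<in> carrier V" "y \<in> carrier V" "z \<in> carrier V"
    and uv: "u \<ge> 0" "v \<ge> 0" "u + v = 1"
  shows "nrm (z \<ominus> (u \<odot>\<^bsub>V\<^esub> x \<oplus> v \<odot>\<^bsub>V\<^esub> y)) \<le> u * nrm (z \<ominus> x) + v * nrm (z \<ominus> y)"
proof -
  have [simp]: "c \<in> carrier reals" for c
    by (simp add: reals_def)
  have "z = u \<odot>\<^bsub>V\<^esub> z \<oplus> v \<odot>\<^bsub>V\<^esub> z"
    using smult_l_distr[of u v z] smult_one[of z] uv by (simp add: reals_def)
  then have "z \<ominus> (u \<odot>\<^bsub>V\<^esub> x \<oplus> v \<odot>\<^bsub>V\<^esub> y)
      = (u \<odot>\<^bsub>V\<^esub> z \<oplus> v \<odot>\<^bsub>V\<^esub> z) \<ominus> (u \<odot>\<^bsub>V\<^esub> x \<oplus> v \<odot>\<^bsub>V\<^esub> y)"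
    by simp
  also have "\<dots> = u \<odot>\<^bsub>V\<^esub> (z \<ominus> x) \<oplus> v \<odot>\<^bsub>V\<^esub> (z \<ominus> y)"
    by (simp add: a_minus_def M.minus_add smult_r_distr smult_r_minus M.a_ac)
  finally have "nrm (z \<ominus> (u \<odot>\<^bsub>V\<^esub> x \<oplus> v \<odot>\<^bsub>V\<^esub> y))
      \<le> nrm (u \<odot>\<^bsub>V\<^esub> (z \<ominus> x)) + nrm (v \<odot>\<^bsub>V\<^esub> (z \<ominus> y))"
    using nrm_triangle by simp
  then show ?thesis
    using uv by (simp add: nrm_smult)
qed

text \<open>Hides the ambient normed space, so that later arguments speak only of
  \<open>mdist Y\<close>. The point \<open>p\<close> is fixed before \<open>z\<close>, as a centre
  has to be.\<close>

lemma Conv_convex_combination: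
  assumes "Y \<in> Conv" "x \<in> mspace Y" "y \<in> mspace Y" "u \<ge> 0" "v \<ge> 0" "u + v = 1"
  obtains p where "p \<in> mspace Y"
    "\<And>z. z \<in> mspace Y \<Longrightarrow> mdist Y z p \<le> u * mdist Y z x + v * mdist Y z y"
proof -
  obtain V nrm where V: "real_normed_space V nrm" and C: "convex_in V (mspace Y)"
    and d: "\<forall>x\<in>mspace Y. \<forall>y\<in>mspace Y. mdist Y x y = nrm (x \<ominus>\<^bsub>V\<^esub> y)"
    using assms(1) by (auto simp: Conv_def)
  interpret real_normed_space V nrm by (rule V)
  show thesis
  proof
    show p: "u \<odot>\<^bsub>V\<^esub> x \<oplus>\<^bsub>V\<^esub> v \<odot>\<^bsub>V\<^esub> y \<in> mspace Y"
      using C assms unfolding convex_in_def by blast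
    show "mdist Y z (u \<odot>\<^bsub>V\<^esub> x \<oplus>\<^bsub>V\<^esub> v \<odot>\<^bsub>V\<^esub> y) \<le> u * mdist Y z x + v * mdist Y z y"
      if z: "z \<in> mspace Y" for z
      using nrm_convex_combination[of x y z u v] C assms p z d
      unfolding convex_in_def by (simp add: subset_eq)
  qed
qed

text \<open>Total weights other than 1 are allowed for the sake of the induction.\<close>

lemma Conv_barycenter:
  assumes "Y \<in> Conv" "finite S" "g \<in> S \<rightarrow> mspace Y" "\<And>s. s \<in> S \<Longrightarrow> c s \<ge> 0" "sum c S > 0"
  shows "\<exists>p\<in>mspace Y. \<forall>z\<in>mspace Y. sum c S * mdist Y z p \<le> (\<Sum>s\<in>S. c s * mdist Y z (g s))"
  using assms(2-)
proof (induction S rule: finite_induct)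
  case (insert a S)
  have c: "c a \<ge> 0" "sum c S \<ge> 0" and ga: "g a \<in> mspace Y"
    using insert.prems by (auto intro: sum_nonneg)
  show ?case
  proof (cases "sum c S = 0")
    case True
    have "0 \<le> (\<Sum>s\<in>S. c s * mdist Y z (g s))" for z
      using insert.prems by (intro sum_nonneg) auto
    then show ?thesis
      using True ga insert.hyps by (intro bexI[of _ "g a"]) auto
  next
    case False
    with c have "sum c S > 0" by simp
    with insert obtain q where q: "q \<in> mspace Y"
      and q_le: "\<forall>z\<in>mspace Y. sum c S * mdist Y z q \<le> (\<Sum>s\<in>S. c s * mdist Y z (g s))"
      by auto
    define t where "t = c a + sum c S"
    have t: "t > 0" using c \<open>sum c S > 0\<close> by (simp add: t_def)
    \<comment> \<open>Combines the new point with the barycentre \<open>q\<close> of the others,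
      each weighted by its share of the total \<open>t\<close>.\<close>
    obtain p where p: "p \<in> mspace Y" and p_le:
      "\<And>z. z \<in> mspace Y \<Longrightarrow> mdist Y z p \<le> c a / t * mdist Y z (g a) + sum c S / t * mdist Y z q"
      using t c by (auto intro: Conv_convex_combination[OF assms(1) ga q, of "c a / t" "sum c S / t"]
        simp: add_divide_distrib[symmetric] t_def)
    have "t * mdist Y z p \<le> c a * mdist Y z (g a) + (\<Sum>s\<in>S. c s * mdist Y z (g s))"
      if z: "z \<in> mspace Y" for z
    proof -
      have "t * mdist Y z p
          \<le> t * (c a / t * mdist Y z (g a) + sum c S / t * mdist Y z q)"
        using p_le[OF z] t by (intro mult_left_mono) auto
      also have "\<dots> = c a * mdist Y z (g a) + sum c S * mdist Y z q"
        using t by (simp add: distrib_left)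
      finally show ?thesis using q_le z by fastforce
    qed
    then show ?thesis
      using p insert.hyps by (auto simp: t_def)
  qed
qed simp

text \<open>Holds for each \<open>f\<close> and \<open>\<mu>\<close> separately, so the supremum
  over maps and the infimum over measures can be taken independently.\<close>

lemma rad_image_le_nn_integral:
  assumes Y: "Y \<in> Conv" and f: "f \<in> nonexpansive_maps X Y"
    and \<mu>: "finite (set_pmf \<mu>)" "set_pmf \<mu> \<subseteq> mspace X"
  shows "rad Y (f ` mspace X)
    \<le> (SUP x\<in>mspace X. \<integral>\<^sup>+ z. ennreal (mdist X x z) \<partial>measure_pmf \<mu>)"
proof -
  have fY: "f x \<in> mspace Y" if "x \<in> mspace X" for x
    using f that by (auto simp: nonexpansive_maps_def)
  have sum1: "sum (pmf \<mu>) (set_pmf \<mu>) = 1"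
    using \<mu> by (intro sum_pmf_eq_1) auto
  then obtain p where p: "p \<in> mspace Y" and
    p_le: "\<forall>z\<in>mspace Y. mdist Y z p \<le> (\<Sum>s\<in>set_pmf \<mu>. pmf \<mu> s * mdist Y z (f s))"
    using Conv_barycenter[OF Y \<mu>(1), of f "pmf \<mu>"] fY \<mu> by auto
  have "ennreal (mdist Y (f x) p) \<le> (\<integral>\<^sup>+ z. ennreal (mdist X x z) \<partial>measure_pmf \<mu>)"
    if x: "x \<in> mspace X" for x
  proof -
    have "mdist Y (f x) p \<le> (\<Sum>s\<in>set_pmf \<mu>. pmf \<mu> s * mdist Y (f x) (f s))"
      using p_le fY[OF x] by blast
    also have "\<dots> \<le> (\<Sum>s\<in>set_pmf \<mu>. pmf \<mu> s * mdist X x s)"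
      using f x \<mu> by (intro sum_mono mult_left_mono) (auto simp: nonexpansive_maps_def)
    finally have "ennreal (mdist Y (f x) p) \<le> ennreal \<dots>"
      by (rule ennreal_leI)
    also have "\<dots> = (\<integral>\<^sup>+ z. ennreal (mdist X x z) \<partial>measure_pmf \<mu>)"
      using \<mu> by (simp add: nn_integral_measure_pmf_finite sum_ennreal[symmetric]
        ennreal_mult'' mult.commute)
    finally show ?thesis .
  qed
  then have "(SUP a\<in>f ` mspace X. ennreal (mdist Y a p))
      \<le> (SUP x\<in>mspace X. \<integral>\<^sup>+ z. ennreal (mdist X x z) \<partial>measure_pmf \<mu>)"
    unfolding image_image by (intro SUP_mono) blast
  then show ?thesis
    unfolding rad_def by (rule INF_lower2[OF p])
qed

section \<open>The Kuratowski map and the lower bound\<close>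

text \<open>The discrete topology makes every bounded function on \<open>'a\<close> continuous.\<close>

definition kuratowski :: "'a metric \<Rightarrow> 'a \<Rightarrow> 'a \<Rightarrow> ('a discrete \<Rightarrow>\<^sub>C real)" where
  "kuratowski X x0 x = Bcontfun (\<lambda>w. if of_discrete w \<in> mspace X
     then mdist X (of_discrete w) x - mdist X (of_discrete w) x0 else 0)"

lemma mdist_diff_le:
  assumes "w \<in> mspace X" "x \<in> mspace X" "y \<in> mspace X"
  shows "\<bar>mdist X w x - mdist X w y\<bar> \<le> mdist X x y"
  using mdist_triangle[of w X x y] mdist_triangle[of w X y x] assms
  by (simp add: mdist_commute abs_le_iff)

text \<open>\<open>Bcontfun\<close> can be unfolded only for bounded continuous functions.
  Subtracting the distance to \<open>x0\<close> gives the bound \<open>mdist X x x0\<close>, even if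
  \<open>X\<close> is unbounded.\<close>

lemma kuratowski_apply:
  assumes "x \<in> mspace X" "x0 \<in> mspace X"
  shows "apply_bcontfun (kuratowski X x0 x) w = (if of_discrete w \<in> mspace X
     then mdist X (of_discrete w) x - mdist X (of_discrete w) x0 else 0)"
proof -
  have "(\<lambda>w. if of_discrete w \<in> mspace X
      then mdist X (of_discrete w) x - mdist X (of_discrete w) x0 else 0) \<in> bcontfun"
    by (rule bcontfun_normI[where b = "mdist X x x0"])
      (use assms in \<open>auto intro!: mdist_diff_le simp: continuous_on_open_vimage open_discrete\<close>)
  then show ?thesis
    by (simp add: kuratowski_def Bcontfun_inverse)
qed

lemma dist_kuratowski_le:
  assumes "x \<in> mspace X" "y \<in> mspace X" "x0 \<in> mspace X"
  shows "dist (kuratowski X x0 x) (kuratowski X x0 y) \<le> mdist X x y"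
  by (rule dist_bound) (use assms in \<open>auto simp: kuratowski_apply dist_real_def mdist_diff_le\<close>)

lemma kuratowski_hull_center:
  assumes x0: "x0 \<in> mspace X" and q: "q \<in> convex hull (kuratowski X x0 ` mspace X)"
  obtains \<mu> :: "'a pmf" where "finite (set_pmf \<mu>)" "set_pmf \<mu> \<subseteq> mspace X"
    "\<And>x. x \<in> mspace X \<Longrightarrow>
       (\<integral>\<^sup>+ z. ennreal (mdist X x z) \<partial>measure_pmf \<mu>) \<le> ennreal (dist (kuratowski X x0 x) q)"
proof -
  let ?K = "kuratowski X x0"
  obtain S u where S: "finite S" "S \<subseteq> ?K ` mspace X" and u: "\<forall>s\<in>S. 0 \<le> u s" "sum u S = 1"
    and q_eq: "(\<Sum>s\<in>S. u s *\<^sub>R s) = q"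
    using q unfolding convex_hull_explicit by auto
  \<comment> \<open>The hull coefficients are indexed by functions in \<open>S\<close>. They form a
    measure \<open>P\<close> there, which is pushed forward to \<open>X\<close> along the chosen
    preimages \<open>g\<close>.\<close>
  define g where "g = inv_into (mspace X) ?K"
  have g: "g s \<in> mspace X" "?K (g s) = s" if "s \<in> S" for s
    using that S unfolding g_def by (auto intro: inv_into_into f_inv_into_f)
  define P where "P = embed_pmf (\<lambda>s. if s \<in> S then u s else 0)"
  have pmf_P: "pmf P s = (if s \<in> S then u s else 0)" for s
    unfolding P_def
  proof (rule pmf_embed_pmf)
    have "(\<integral>\<^sup>+ s. ennreal (if s \<in> S then u s else 0) \<partial>count_space UNIV)
        = (\<Sum>s\<in>S. ennreal (u s))"
      using S by (subst nn_integral_count_space'[of S]) auto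
    then show "(\<integral>\<^sup>+ s. ennreal (if s \<in> S then u s else 0) \<partial>count_space UNIV) = 1"
      using u by (simp add: sum_ennreal)
  qed (use u in auto)
  \<comment> \<open>Only an inclusion, because some coefficients \<open>u s\<close> may be 0; the
    integral is therefore summed over \<open>S\<close>.\<close>
  have P_sub: "set_pmf P \<subseteq> S"
    by (auto simp: set_pmf_iff pmf_P split: if_splits)
  show thesis
  proof
    show "finite (set_pmf (map_pmf g P))"
      using finite_subset[OF P_sub S(1)] by simp
    show "set_pmf (map_pmf g P) \<subseteq> mspace X"
      using P_sub g by auto
    fix x assume x: "x \<in> mspace X"
    have "(\<integral>\<^sup>+ z. ennreal (mdist X x z) \<partial>measure_pmf (map_pmf g P))
        = (\<Sum>s\<in>S. ennreal (mdist X x (g s)) * ennreal (pmf P s))"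
      unfolding nn_integral_map_pmf
      by (rule nn_integral_measure_pmf_support) (use S P_sub in auto)
    also have "\<dots> = ennreal (\<Sum>s\<in>S. u s * mdist X x (g s))"
      using u by (simp add: pmf_P sum_ennreal[symmetric] ennreal_mult'' mult.commute)
    \<comment> \<open>As the weights sum to 1, \<open>q\<close> at \<open>x\<close> is the average
      distance minus \<open>mdist X x x0\<close>. \<open>?K x\<close> at \<open>x\<close> is
      \<open>- mdist X x x0\<close>, so the base point terms cancel.\<close>
    also have "(\<Sum>s\<in>S. u s * mdist X x (g s))
        = apply_bcontfun q (discrete x) - apply_bcontfun (?K x) (discrete x)"
    proof -
      have "apply_bcontfun q w = (\<Sum>s\<in>S. u s * apply_bcontfun s w)" for w
        unfolding q_eq[symmetric] using S(1) by (induction S rule: finite_induct) auto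
      then have "apply_bcontfun q (discrete x) = (\<Sum>s\<in>S. u s * apply_bcontfun (?K (g s)) (discrete x))"
        using g by (simp cong: sum.cong)
      also have "\<dots> = (\<Sum>s\<in>S. u s * (mdist X x (g s) - mdist X x x0))"
        using g(1) x x0 by (intro sum.cong) (auto simp: kuratowski_apply discrete_inverse)
      also have "\<dots> = (\<Sum>s\<in>S. u s * mdist X x (g s)) - mdist X x x0"
        using u by (simp add: right_diff_distrib sum_subtractf sum_distrib_right[symmetric])
      finally show ?thesis
        using x x0 by (simp add: kuratowski_apply discrete_inverse)
    qed
    \<comment> \<open>The difference at a single point is at most the supremum distance.\<close>
    also have "\<dots> \<le> dist (?K x) q"
      using dist_bounded[of "?K x" "discrete x" q] by (simp add: dist_real_def)
    finally show "(\<integral>\<^sup>+ z. ennreal (mdist X x z) \<partial>measure_pmf (map_pmf g P))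
        \<le> ennreal (dist (?K x) q)"
      by (simp add: ennreal_leI)
  qed
qed

theorem theorem11:
  fixes X :: "'a metric"
  assumes "mspace X \<noteq> {}"
  shows "map_rad_class X (Conv :: ('v + ('a \<Rightarrow> real)) metric set) =
    (INF \<mu>\<in>{\<mu> :: 'a pmf. finite (set_pmf \<mu>) \<and> set_pmf \<mu> \<subseteq> mspace X}.
       SUP x\<in>mspace X. \<integral>\<^sup>+ z. ennreal (mdist X x z) \<partial>measure_pmf \<mu>)"
    (is "?L = ?R")
proof (rule antisym)
  show "?L \<le> ?R"
    unfolding map_rad_class_def map_rad_def
    by (intro SUP_least INF_greatest) (auto intro: rad_image_le_nn_integral)
next
  obtain x0 where x0: "x0 \<in> mspace X"
    using assms by blast
  let ?K = "kuratowski X x0"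
  \<comment> \<open>Taking only the hull as target forces every admissible centre to be a finite
    average of image points.\<close>
  define C where "C = convex hull (?K ` mspace X)"
  \<comment> \<open>Places the bounded functions in the right summand of the universe, which exists
    for this purpose; \<open>Y\<close> is the copy of \<open>C\<close> there.\<close>
  define e :: "('a discrete \<Rightarrow>\<^sub>C real) \<Rightarrow> 'v + ('a \<Rightarrow> real)"
    where "e h = Inr (\<lambda>a. apply_bcontfun h (discrete a))" for h
  have "inj e"
  proof (rule injI)
    fix h k assume "e h = e k"
    then have "apply_bcontfun h (discrete a) = apply_bcontfun k (discrete a)" for a
      by (simp add: e_def fun_eq_iff)
    then show "h = k"
      by (metis bcontfun_eqI of_discrete_inverse)
  qed
  define Y where "Y = metric (e ` C, \<lambda>x y. dist (inv_into UNIV e x) (inv_into UNIV e y))"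
  have spY: "mspace Y = e ` C" and dY: "\<And>x y. mdist Y (e x) (e y) = dist x y" and Y: "Y \<in> Conv"
    using Conv_real_normed_vector[OF _ \<open>inj e\<close>, of C] by (auto simp: Y_def C_def)
  have f: "(\<lambda>x. e (?K x)) \<in> nonexpansive_maps X Y"
    using x0 by (auto simp: nonexpansive_maps_def spY dY C_def dist_kuratowski_le hull_inc)
  have "?R \<le> rad Y ((\<lambda>x. e (?K x)) ` mspace X)"
    unfolding rad_def
  \<comment> \<open>Each candidate centre \<open>q\<close> yields its own \<open>\<mu>\<close>,
    whose supremum of integrals bounds the radius about \<open>q\<close> from below.\<close>
  proof (rule INF_greatest)
    fix y assume "y \<in> mspace Y"
    then obtain q where y: "y = e q" and q: "q \<in> C"
      by (auto simp: spY)
    obtain \<mu> :: "'a pmf" where \<mu>: "finite (set_pmf \<mu>)" "set_pmf \<mu> \<subseteq> mspace X" and le: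
      "\<And>x. x \<in> mspace X \<Longrightarrow> (\<integral>\<^sup>+ z. ennreal (mdist X x z) \<partial>measure_pmf \<mu>) \<le> ennreal (dist (?K x) q)"
      using kuratowski_hull_center[OF x0 q[unfolded C_def]] by blast
    have "?R \<le> (SUP x\<in>mspace X. \<integral>\<^sup>+ z. ennreal (mdist X x z) \<partial>measure_pmf \<mu>)"
      using \<mu> by (intro INF_lower) simp
    also have "\<dots> \<le> (SUP x\<in>mspace X. ennreal (dist (?K x) q))"
      using le by (intro SUP_mono) blast
    finally show "?R \<le> (SUP a\<in>(\<lambda>x. e (?K x)) ` mspace X. ennreal (mdist Y a y))"
      by (simp add: image_image y dY)
  qed
  also have "\<dots> \<le> map_rad X Y"
    unfolding map_rad_def using f by (rule SUP_upper)
  also have "\<dots> \<le> ?L"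
    unfolding map_rad_class_def using Y by (rule SUP_upper)
  finally show "?R \<le> ?L" .
qed

end
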